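(* If $n=pq$ with primes $p<q$, then the domination polynomial $D(\Gamma(\mathbb{Z}_n),x)$ of the co-maximal graph of $\mathbb{Z}_n$ is log-concave and unimodal.
   Context: All graphs are finite, simple and undirected. The co-maximal graph $\Gamma(\mathbb{Z}_n)$ has vertex set $\mathbb{Z}_n$, and two distinct elements $a,b$ are adjacent if and only if $a\mathbb{Z}_n+b\mathbb{Z}_n=\mathbb{Z}_n$. A dominating set of a graph $G$ is a non-empty set $S\subseteq V(G)$ such that every vertex of $V(G)\setminus S$ is adjacent to at least one vertex of $S$. The domination polynomial of $G$ is $D(G,x)=\sum_{k} D(G,k)x^k$, where $D(G,k)$ is the number of dominating sets of $G$ of cardinality $k$. A polynomial $e(x)=\sum_{i=0}^{N}e_ix^i$ of degree $N$ is unimodal if there is an index $\ell$ with $e_0\le e_1\le\cdots\le e_\ell\ge e_{\ell+1}\ge\cdots\ge e_N$, and log-concave if $e_i^2\ge e_{i-1}e_{i+1}$ for all $1\le i\le N-1$. *)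

theory Defs
  imports
    "HOL-Number_Theory.Residues"
    "HOL-Computational_Algebra.Polynomial"
    "Graph_Theory.Pair_Digraph"
begin

text \<open>
  A finite simple undirected graph is a digraph without parallel arcs satisfying the locale
  \<^locale>\<open>pair_graph\<close>; an undirected edge corresponds to a pair of opposite arcs.
\<close>

definition comaximal_graph :: "nat \<Rightarrow> int pair_pre_digraph" where
  "comaximal_graph n = (let R = residue_ring (int n) in
     \<lparr> pverts = carrier R,
       parcs = {(a, b). a \<in> carrier R \<and> b \<in> carrier R \<and> a \<noteq> b \<and>
                        PIdl\<^bsub>R\<^esub> a <+>\<^bsub>R\<^esub> PIdl\<^bsub>R\<^esub> b = carrier R} \<rparr>)"

lemma pair_graph_comaximal_graph: "pair_graph (comaximal_graph n)"
proof -
  let ?R = "residue_ring (int n)" and ?G = "comaximal_graph n"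
  have "x \<oplus>\<^bsub>?R\<^esub> y = y \<oplus>\<^bsub>?R\<^esub> x" for x y
    by (simp add: residue_ring_def add.commute)
  then have comm: "A <+>\<^bsub>?R\<^esub> B = B <+>\<^bsub>?R\<^esub> A" for A B
    unfolding set_add_def' by blast
  have verts: "pverts ?G = carrier ?R"
    by (simp only: comaximal_graph_def Let_def pair_pre_digraph.simps)
  have arcs: "(a, b) \<in> parcs ?G \<longleftrightarrow> a \<in> carrier ?R \<and> b \<in> carrier ?R \<and> a \<noteq> b \<and>
                PIdl\<^bsub>?R\<^esub> a <+>\<^bsub>?R\<^esub> PIdl\<^bsub>?R\<^esub> b = carrier ?R" for a b
    by (simp only: comaximal_graph_def Let_def pair_pre_digraph.simps mem_Collect_eq prod.case)
  have fin: "finite (pverts ?G)"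
    by (simp add: verts residue_ring_def)
  have sub: "parcs ?G \<subseteq> pverts ?G \<times> pverts ?G"
    unfolding verts by (rule subrelI) (simp only: arcs mem_Sigma_iff)
  have sym: "symmetric (with_proj ?G)"
    unfolding symmetric_def with_proj_simps
  proof (rule symI)
    fix a b assume "(a, b) \<in> parcs ?G"
    then show "(b, a) \<in> parcs ?G"
      unfolding arcs comm[of "PIdl\<^bsub>?R\<^esub> b"]
      by (elim conjE) (intro conjI; (assumption | rule not_sym, assumption))
  qed
  show ?thesis
  proof
    fix e assume e: "e \<in> parcs ?G"
    obtain a b where ab: "e = (a, b)" by (cases e)
    show "fst e \<in> pverts ?G" "snd e \<in> pverts ?G"
      using e sub ab by fastforce+
    show "fst e \<noteq> snd e"
      using e by (simp only: ab arcs fst_conv snd_conv not_False_eq_True)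
  next
    show "finite (pverts ?G)" by (fact fin)
    show "finite (parcs ?G)"
      using sub fin by (meson finite_SigmaI finite_subset)
    show "symmetric (with_proj ?G)" by (fact sym)
  qed
qed

definition dominating_set :: "'a pair_pre_digraph \<Rightarrow> 'a set \<Rightarrow> bool" where
  "dominating_set G S \<longleftrightarrow>
     S \<noteq> {} \<and> S \<subseteq> pverts G \<and> (\<forall>v \<in> pverts G - S. \<exists>u \<in> S. v \<rightarrow>\<^bsub>G\<^esub> u)"

definition domination_poly :: "'a pair_pre_digraph \<Rightarrow> int poly" where
  "domination_poly G =
     (\<Sum>k\<le>card (pverts G). monom (int (card {S. dominating_set G S \<and> card S = k})) k)"

definition unimodal :: "'a::linordered_idom poly \<Rightarrow> bool" where
  "unimodal e \<longleftrightarrow> (\<exists>l\<le>degree e.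
     (\<forall>i<l. coeff e i \<le> coeff e (Suc i)) \<and>
     (\<forall>i. l \<le> i \<and> i < degree e \<longrightarrow> coeff e i \<ge> coeff e (Suc i)))"

text \<open>
  The range of \<open>i\<close> is empty for polynomials of degree at most 1, so the truncated
  subtraction on \<^typ>\<open>nat\<close> is harmless.
\<close>

definition log_concave :: "'a::linordered_idom poly \<Rightarrow> bool" where
  "log_concave e \<longleftrightarrow>
     (\<forall>i. 1 \<le> i \<and> i \<le> degree e - 1 \<longrightarrow> (coeff e i)\<^sup>2 \<ge> coeff e (i - 1) * coeff e (i + 1))"

end

theory Submission
  imports Defs
begin

text \<open>
  The structure of \<open>\<Gamma>(\<int>\<^sub>n)\<close> enters only through its many universal vertices, those
  adjacent to every other vertex. Every set containing a universal vertex dominates, so in a graph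
  with \<open>n\<close> vertices of which \<open>m\<close> are not universal, the number \<open>D\<^sub>k\<close> of dominating
  sets of size \<open>k\<close> satisfies
  \<open>(n choose k) - (m choose k) \<le> D\<^sub>k \<le> (n choose k)\<close>.
  The binomial coefficients in the upper bound form a log-concave sequence with slack: for
  \<open>0 < k < n\<close>, the quotient of \<open>(n choose k)\<^sup>2\<close> by the product of its two neighbours is
  \<open>1 + (n + 1) / (k (n - k))\<close>. If \<open>2 m \<le> n + 2\<close>, the relative error
  \<open>(m choose k) / (n choose k)\<close> decays roughly like \<open>2\<^sup>-\<^sup>k\<close> or faster, and from \<open>k = 3\<close> on it is
  small enough to be absorbed by this slack (\<open>choose_gap_log_concave\<close>).

  For \<open>k = 2\<close> the error can be too large, but the exact value \<open>D\<^sub>1 = n - m\<close>, a single vertex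
  dominating precisely when it is universal, makes up for it (\<open>choose_gap_log_concave_two\<close>).
  For \<open>k = 1\<close> there is nothing to prove because \<open>D\<^sub>0 = 0\<close>. Since \<open>D\<^sub>k > 0\<close> for
  \<open>1 \<le> k \<le> n\<close>, unimodality follows from log-concavity. Thus the conclusion holds for every
  finite graph that has a universal vertex and satisfies \<open>2 m \<le> n + 2\<close>
  (\<open>domination_poly_log_concave_unimodal\<close>).

  In \<open>\<Gamma>(\<int>\<^sub>n)\<close> each unit is universal, as it generates the whole ring. For \<open>n = p q\<close> there
  are \<open>(p - 1)(q - 1)\<close> units, and the condition on \<open>m\<close> follows from
  \<open>2 (p - 1)(q - 1) + 2 - p q = (p - 2)(q - 2) \<ge> 0\<close>.
\<close>

section \<open>Unimodality from log-concavity\<close>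

text \<open>
  Log-concavity propagates a descent: if \<open>e\<^sub>i \<ge> e\<^sub>i\<^sub>+\<^sub>1 > 0\<close>, then
  \<open>e\<^sub>i\<^sub>+\<^sub>1\<^sup>2 \<ge> e\<^sub>i e\<^sub>i\<^sub>+\<^sub>2 \<ge> e\<^sub>i\<^sub>+\<^sub>1 e\<^sub>i\<^sub>+\<^sub>2\<close>, and cancelling
  \<open>e\<^sub>i\<^sub>+\<^sub>1\<close> gives the next descent. The peak is therefore the first index at which a descent
  starts. The constant coefficient is never cancelled, so it may vanish, as it does for domination
  polynomials.
\<close>

lemma log_concave_imp_unimodal:
  fixes e :: "'a::linordered_idom poly"
  assumes lc: "log_concave e"
    and pos: "\<And>i. 1 \<le> i \<Longrightarrow> i \<le> degree e \<Longrightarrow> coeff e i > 0"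
  shows "unimodal e"
proof -
  let ?P = "\<lambda>l. l = degree e \<or> l < degree e \<and> coeff e (Suc l) \<le> coeff e l"
  define l where "l = (LEAST l. ?P l)"
  have P: "?P l"
    unfolding l_def by (rule LeastI[of ?P "degree e"]) simp
  then have l_le: "l \<le> degree e"
    by auto
  have rise: "coeff e i \<le> coeff e (Suc i)" if "i < l" for i
    using not_less_Least[of i ?P] that l_le unfolding l_def[symmetric] by auto
  have fall: "coeff e (Suc i) \<le> coeff e i" if "l \<le> i" "i < degree e" for i
    using that
  proof (induction i rule: dec_induct)
    case base
    then show ?case using P by auto
  next
    case (step i)
    have "coeff e (Suc i) * coeff e (Suc (Suc i)) \<le> coeff e i * coeff e (Suc (Suc i))"
      using step pos[of "Suc (Suc i)"] by (intro mult_right_mono) auto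
    also have "\<dots> \<le> coeff e (Suc i) * coeff e (Suc i)"
      using lc[unfolded log_concave_def, rule_format, of "Suc i"] step.prems
      by (simp add: power2_eq_square)
    finally show ?case
      using pos[of "Suc i"] step.prems by (simp add: mult_le_cancel_left)
  qed
  show ?thesis
    unfolding unimodal_def using l_le rise fall by blast
qed

section \<open>Binomial estimates\<close>

lemma int_choose_two: "2 * int (n choose 2) = int n * (int n - 1)"
  by (induction n) (simp_all add: numeral_2_eq_2 algebra_simps)

lemma int_choose_three: "6 * int (n choose 3) = int n * (int n - 1) * (int n - 2)"
proof (induction n)
  case (Suc n)
  have "int (Suc n choose 3) = int (n choose 2) + int (n choose 3)"
    by (simp add: numeral_3_eq_3 numeral_2_eq_2)
  then show ?case
    using Suc int_choose_two[of n] by (simp add: algebra_simps)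
qed simp

lemma int_choose_Suc:
  assumes "k \<le> n"
  shows "(int k + 1) * int (n choose Suc k) = (int n - int k) * int (n choose k)"
proof -
  have "Suc k * (n choose Suc k) = (n - k) * (n choose k)"
    by (simp only: binomial_absorption binomial_absorb_comp)
  then have "int (Suc k * (n choose Suc k)) = int ((n - k) * (n choose k))"
    by simp
  then show ?thesis
    using assms by (simp add: of_nat_diff algebra_simps)
qed

text \<open>
  This inequality says that twice the relative error \<open>(m choose k) / (n choose k)\<close> is at most
  \<open>(n + 1) / ((k + 1) (n + 1 - k))\<close>, the proportion of \<open>(n choose k)\<^sup>2\<close> by which
  \<open>(n choose (k - 1)) (n choose (k + 1))\<close> falls short of it. In the extremal case \<open>2 m = n + 2\<close>, the instance \<open>k = 3\<close> amounts to
  \<open>n\<^sup>3 - 4 n \<le> n\<^sup>3 - n\<close>. Passing from \<open>k\<close> to \<open>k + 1\<close> multiplies the error by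
  \<open>(m - k) / (n - k)\<close>, at most about one half, whereas the right-hand side shrinks more slowly.
\<close>

lemma choose_halved_bound:
  assumes "2 * m \<le> n + 2" and "3 \<le> k" and "k \<le> n"
  shows "2 * (int k + 1) * (int n + 1 - int k) * int (m choose k)
          \<le> (int n + 1) * int (n choose k)"
  using assms(2,3)
proof (induction k rule: dec_induct)
  case base
  have "2 * int m * (2 * (int m - 1)) * (2 * (int m - 2)) \<le> (int n + 2) * int n * (int n - 2)"
  proof (cases "m \<ge> 2")
    case True
    then show ?thesis using assms(1) base by (intro mult_mono) auto
  next
    case False
    then have "m = 0 \<or> m = 1" by auto
    then show ?thesis using base by auto
  qed
  also have "\<dots> \<le> (int n + 1) * (int n * (int n - 1))"
    by (simp add: algebra_simps)
  finally have "48 * int (m choose 3) \<le> (int n + 1) * (int n * (int n - 1))"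
    using int_choose_three[of m] by (simp add: algebra_simps)
  then have "(int n - 2) * (48 * int (m choose 3)) \<le> (int n - 2) * ((int n + 1) * (int n * (int n - 1)))"
    using base by (intro mult_left_mono) auto
  also have "\<dots> = (int n + 1) * (6 * int (n choose 3))"
    unfolding int_choose_three by (simp add: algebra_simps)
  finally show ?case by (simp add: algebra_simps)
next
  case (step k)
  show ?case
  proof (cases "k < m")
    case False
    then show ?thesis by (simp add: binomial_eq_0)
  next
    case True
    have "(int k + 2) * (2 * (int m - int k)) \<le> (2 * (int k + 1)) * (int n + 1 - int k)"
      using assms(1) step True by (intro mult_mono) auto
    then have "(int k + 2) * (2 * (int m - int k)) * int (m choose k)
      \<le> 2 * (int k + 1) * (int n + 1 - int k) * int (m choose k)"
      by (intro mult_right_mono) auto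
    also have "\<dots> \<le> (int n + 1) * int (n choose k)"
      using step by simp
    finally have "(int n - int k) * ((int k + 2) * (2 * (int m - int k)) * int (m choose k))
       \<le> (int n - int k) * ((int n + 1) * int (n choose k))"
      using step.prems by (intro mult_left_mono) auto
    then have "2 * (int k + 2) * (int n - int k) * ((int m - int k) * int (m choose k))
       \<le> (int n + 1) * ((int n - int k) * int (n choose k))"
      by (simp only: mult_ac)
    then have "2 * (int k + 2) * (int n - int k) * ((int k + 1) * int (m choose Suc k))
       \<le> (int n + 1) * ((int k + 1) * int (n choose Suc k))"
      using int_choose_Suc[of k m] int_choose_Suc[of k n] True step.prems by simp
    then have "(int k + 1) * (2 * (int k + 2) * (int n - int k) * int (m choose Suc k))
       \<le> (int k + 1) * ((int n + 1) * int (n choose Suc k))"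
      by (simp only: mult_ac)
    then have "2 * (int k + 2) * (int n - int k) * int (m choose Suc k)
       \<le> (int n + 1) * int (n choose Suc k)"
      by (rule mult_left_le_imp_le) simp
    then show ?thesis by (simp add: algebra_simps)
  qed
qed

text \<open>
  Write \<open>N = (n choose k)\<close> and \<open>M = (m choose k)\<close>. The neighbours of \<open>N\<close> are multiples of
  \<open>N\<close>, and their product is \<open>k (n - k) / P \<cdot> N\<^sup>2\<close> with \<open>P = (k + 1) (n + 1 - k)\<close>. Since
  \<open>k (n - k) = P - (n + 1)\<close>, the preceding bound on \<open>M\<close> places this product below
  \<open>N\<^sup>2 - 2 N M \<le> (N - M)\<^sup>2\<close>.
\<close>

lemma choose_gap_log_concave:
  assumes "2 * m \<le> n + 2" and "3 \<le> k" and "k < n"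
  shows "int (n choose (k - 1)) * int (n choose (k + 1))
          \<le> (int (n choose k) - int (m choose k))\<^sup>2"
proof -
  let ?N = "int (n choose k)" and ?M = "int (m choose k)"
  let ?A = "int (n choose (k - 1))" and ?B = "int (n choose (k + 1))"
  let ?P = "(int k + 1) * (int n + 1 - int k)"
  have A: "(int n + 1 - int k) * ?A = int k * ?N"
    using int_choose_Suc[of "k - 1" n] assms by (simp add: of_nat_diff algebra_simps)
  have B: "(int k + 1) * ?B = (int n - int k) * ?N"
    using int_choose_Suc[of k n] assms by simp
  have P_pos: "0 < ?P"
    using assms by (intro mult_pos_pos) auto
  have "?P * (?A * ?B) = ((int n + 1 - int k) * ?A) * ((int k + 1) * ?B)"
    by (simp only: mult_ac)
  also have "\<dots> = ?P * ?N\<^sup>2 - ?N * ((int n + 1) * ?N)"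
    unfolding A B by (simp add: algebra_simps power2_eq_square)
  also have "\<dots> \<le> ?P * ?N\<^sup>2 - ?N * (2 * (int k + 1) * (int n + 1 - int k) * ?M)"
    using mult_left_mono[OF choose_halved_bound[OF assms(1,2)], of ?N] assms by simp
  also have "\<dots> = ?P * (?N\<^sup>2 - 2 * ?N * ?M)"
    by (simp add: algebra_simps)
  also have "\<dots> \<le> ?P * (?N - ?M)\<^sup>2"
    using P_pos by (intro mult_left_mono) (simp_all add: power2_diff)
  finally show ?thesis
    by (rule mult_left_le_imp_le) (fact P_pos)
qed

text \<open>
  The left-hand side carries the factor \<open>n - m\<close> in place of \<open>n choose 1\<close>. This is what makes
  the estimate hold: the gap on the right also contains \<open>n - m\<close> as a factor, so one copy of it
  is matched exactly and only the other has to be estimated, by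
  \<open>m (m - 1) \<le> n (n + 2) / 4\<close>.
\<close>

lemma choose_gap_log_concave_two:
  assumes "2 * m \<le> n + 2" and "m \<le> n" and "2 < n"
  shows "(int n - int m) * int (n choose 3)
          \<le> (int (n choose 2) - int (m choose 2))\<^sup>2"
proof -
  let ?n = "int n" and ?m = "int m"
  let ?g = "int (n choose 2) - int (m choose 2)"
  have g: "2 * ?g = (?n - ?m) * (?n + ?m - 1)"
    using int_choose_two[of n] int_choose_two[of m] by (simp add: algebra_simps)
  have "2 * ?m * (2 * (?m - 1)) \<le> (?n + 2) * ?n"
  proof (cases "m = 0")
    case False
    then show ?thesis using assms by (intro mult_mono) auto
  qed simp
  then have g34: "3 * ?n * (?n - 2) \<le> 8 * ?g"
    using int_choose_two[of n] int_choose_two[of m] by (simp add: algebra_simps)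
  have g0: "0 \<le> ?g"
    using assms by (simp add: binomial_right_mono)
  have "72 * ((?n - ?m) * int (n choose 3)) = 12 * (?n - ?m) * (6 * int (n choose 3))"
    by simp
  also have "\<dots> = 4 * (?n - ?m) * (?n - 1) * (3 * ?n * (?n - 2))"
    unfolding int_choose_three by (simp only: mult_ac mult_numeral_left_semiring_numeral) simp
  also have "\<dots> \<le> 4 * (?n - ?m) * (?n - 1) * (8 * ?g)"
    using g34 assms by (intro mult_left_mono) auto
  also have "\<dots> \<le> 4 * (?n - ?m) * (?n + ?m - 1) * (8 * ?g)"
    using g0 assms by (intro mult_right_mono mult_left_mono) auto
  also have "\<dots> = 64 * ?g\<^sup>2"
    using arg_cong[OF g, of "\<lambda>x. 32 * ?g * x"]
    by (simp only: power2_eq_square mult_ac)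
  finally show ?thesis using zero_le_power2[of ?g] by linarith
qed

section \<open>Domination polynomials of graphs with many universal vertices\<close>

definition universal_vertices :: "'a pair_pre_digraph \<Rightarrow> 'a set" where
  "universal_vertices G = {u \<in> pverts G. \<forall>v \<in> pverts G - {u}. v \<rightarrow>\<^bsub>G\<^esub> u}"

lemma coeff_domination_poly:
  assumes "finite (pverts G)"
  shows "coeff (domination_poly G) k = int (card {S. dominating_set G S \<and> card S = k})"
proof (cases "k \<le> card (pverts G)")
  case True
  then show ?thesis
    by (simp add: domination_poly_def coeff_sum)
next
  case False
  then have "{S. dominating_set G S \<and> card S = k} = {}"
    using card_mono[OF assms] by (auto simp: dominating_set_def)
  with False show ?thesis
    by (simp only: domination_poly_def coeff_sum coeff_monom) simp
qed

lemma coeff_domination_poly_0: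
  assumes "finite (pverts G)"
  shows "coeff (domination_poly G) 0 = 0"
proof -
  have "{S. dominating_set G S \<and> card S = 0} = {}"
    using finite_subset[OF _ assms] by (auto simp: dominating_set_def)
  then show ?thesis
    by (simp only: coeff_domination_poly[OF assms]) simp
qed

lemma coeff_domination_poly_1:
  assumes "finite (pverts G)"
  shows "coeff (domination_poly G) 1 = int (card (universal_vertices G))"
proof -
  have "{S. dominating_set G S \<and> card S = 1} = (\<lambda>u. {u}) ` universal_vertices G"
    by (auto simp: dominating_set_def universal_vertices_def card_1_singleton_iff)
  then show ?thesis
    by (simp add: coeff_domination_poly[OF assms] card_image)
qed

lemma coeff_domination_poly_le:
  assumes "finite (pverts G)"
  shows "coeff (domination_poly G) k \<le> int (card (pverts G) choose k)"
proof -
  have "card {S. dominating_set G S \<and> card S = k} \<le> card {S. S \<subseteq> pverts G \<and> card S = k}"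
    using assms by (intro card_mono) (auto simp: dominating_set_def)
  then show ?thesis
    by (simp add: coeff_domination_poly n_subsets assms)
qed

text \<open>
  A set that fails to dominate avoids all universal vertices.
\<close>

lemma coeff_domination_poly_ge:
  assumes fin: "finite (pverts G)"
  shows "int (card (pverts G) choose k)
           - int ((card (pverts G) - card (universal_vertices G)) choose k)
         \<le> coeff (domination_poly G) k"
proof -
  let ?V = "pverts G" and ?U = "universal_vertices G"
  let ?D = "{S. dominating_set G S \<and> card S = k}"
  have U: "?U \<subseteq> ?V" by (auto simp: universal_vertices_def)
  have finD: "finite ?D"
    by (rule finite_subset[of _ "Pow ?V"]) (use fin in \<open>auto simp: dominating_set_def\<close>)
  have "dominating_set G S" if "S \<subseteq> ?V" "u \<in> S" "u \<in> ?U" for S u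
    using that unfolding dominating_set_def universal_vertices_def by blast
  then have "{S. S \<subseteq> ?V \<and> card S = k} \<subseteq> ?D \<union> {S. S \<subseteq> ?V - ?U \<and> card S = k}"
    by blast
  then have "card {S. S \<subseteq> ?V \<and> card S = k} \<le> card (?D \<union> {S. S \<subseteq> ?V - ?U \<and> card S = k})"
    using fin finD by (intro card_mono) auto
  also have "\<dots> \<le> card ?D + card {S. S \<subseteq> ?V - ?U \<and> card S = k}"
    by (rule card_Un_le)
  finally have "card ?V choose k \<le> card ?D + ((card ?V - card ?U) choose k)"
    using fin U by (simp add: n_subsets card_Diff_subset finite_subset[OF U])
  then show ?thesis
    by (simp add: coeff_domination_poly[OF fin])
qed

text \<open>
  Replacing the neighbours of \<open>D\<^sub>k\<close> by their upper bounds and \<open>D\<^sub>k\<close> itself by its lower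
  bound reduces log-concavity to the two binomial estimates, applied with \<open>m\<close> the number of
  vertices that are not universal. A universal vertex makes \<open>m < n\<close>, hence the lower bound
  positive for \<open>1 \<le> k \<le> n\<close>, which is what unimodality requires.
\<close>

lemma domination_poly_log_concave_unimodal:
  assumes fin: "finite (pverts G)"
    and U_ne: "universal_vertices G \<noteq> {}"
    and many: "card (pverts G) \<le> 2 * card (universal_vertices G) + 2"
  shows "log_concave (domination_poly G) \<and> unimodal (domination_poly G)"
proof -
  let ?D = "coeff (domination_poly G)"
  define n where "n = card (pverts G)"
  define m where "m = n - card (universal_vertices G)"
  have U: "universal_vertices G \<subseteq> pverts G" by (auto simp: universal_vertices_def)
  have u_pos: "0 < card (universal_vertices G)"
    using U_ne finite_subset[OF U fin] by (simp add: card_gt_0_iff)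
  have u_le: "card (universal_vertices G) \<le> n"
    unfolding n_def using card_mono[OF fin U] .
  have m: "m < n" "2 * m \<le> n + 2" "int n - int m = int (card (universal_vertices G))"
    using u_pos u_le many by (auto simp: m_def n_def)
  have upper: "?D k \<le> int (n choose k)" for k
    using coeff_domination_poly_le[OF fin] by (simp add: n_def)
  have lower: "int (n choose k) - int (m choose k) \<le> ?D k" for k
    using coeff_domination_poly_ge[OF fin] by (simp add: n_def m_def)
  have gap_nonneg: "0 \<le> int (n choose k) - int (m choose k)" for k
    using m by (simp add: binomial_right_mono)
  have pos: "0 < ?D k" if k: "1 \<le> k" "k \<le> n" for k
  proof -
    \<comment> \<open>Strictness comes from the \<open>k\<close>-subsets that contain a fixed vertex outside the \<open>m\<close>.\<close>
    have "m choose k < n choose k"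
    proof -
      obtain j where j: "k = Suc j" using k by (cases k) auto
      obtain n' where n': "n = Suc n'" using m by (cases n) auto
      have "m choose k \<le> n' choose k" using m n' by (intro binomial_right_mono) simp
      moreover have "0 < n' choose j" using k j n' by simp
      ultimately show ?thesis
        unfolding j n' binomial_Suc_Suc by linarith
    qed
    then show ?thesis using lower[of k] by simp
  qed
  have deg: "degree (domination_poly G) = n"
  proof (rule antisym)
    show "degree (domination_poly G) \<le> n"
    proof (rule degree_le, intro allI impI)
      fix k assume "n < k"
      then have "?D k \<le> 0" using upper[of k] by (simp add: binomial_eq_0)
      then show "?D k = 0" using gap_nonneg[of k] lower[of k] by linarith
    qed
    show "n \<le> degree (domination_poly G)"
      using pos[of n] m by (intro le_degree) auto
  qed
  have "?D (k - 1) * ?D (k + 1) \<le> (?D k)\<^sup>2" if k: "1 \<le> k" "k \<le> n - 1" for k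
  proof -
    have nonneg: "0 \<le> ?D j" for j
      using gap_nonneg[of j] lower[of j] by linarith
    have square: "(int (n choose k) - int (m choose k))\<^sup>2 \<le> (?D k)\<^sup>2"
      using lower gap_nonneg by (intro power_mono) auto
    consider "k = 1" | "k = 2" | "3 \<le> k" using k by linarith
    then show ?thesis
    proof cases
      case 1
      then show ?thesis by (simp add: coeff_domination_poly_0[OF fin])
    next
      case 2
      have "?D 1 * ?D 3 \<le> (int n - int m) * int (n choose 3)"
        unfolding m(3) coeff_domination_poly_1[OF fin] using upper[of 3]
        by (intro mult_left_mono) auto
      also have "\<dots> \<le> (int (n choose 2) - int (m choose 2))\<^sup>2"
        using m k 2 by (intro choose_gap_log_concave_two) auto
      finally show ?thesis using square 2 by simp
    next
      case 3
      have "?D (k - 1) * ?D (k + 1) \<le> int (n choose (k - 1)) * int (n choose (k + 1))"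
        using upper nonneg by (intro mult_mono) auto
      also have "\<dots> \<le> (int (n choose k) - int (m choose k))\<^sup>2"
        using m k 3 by (intro choose_gap_log_concave) auto
      finally show ?thesis using square by simp
    qed
  qed
  then have lc: "log_concave (domination_poly G)"
    unfolding log_concave_def deg by blast
  moreover have "unimodal (domination_poly G)"
    using log_concave_imp_unimodal[OF lc] pos deg by simp
  ultimately show ?thesis ..
qed

section \<open>Universal vertices of the co-maximal graph\<close>

lemma pverts_comaximal_graph: "pverts (comaximal_graph n) = carrier (residue_ring (int n))"
  by (simp only: comaximal_graph_def Let_def pair_pre_digraph.simps)

lemma card_pverts_comaximal_graph: "card (pverts (comaximal_graph n)) = n"
  by (simp add: pverts_comaximal_graph residue_ring_def)

lemma (in cring) ideal_sum_unit_eq_carrier: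
  assumes "a \<in> carrier R" and "u \<in> Units R"
  shows "PIdl a <+>\<^bsub>R\<^esub> PIdl u = carrier R"
proof -
  have u: "u \<in> carrier R"
    using assms(2) by (rule Units_closed)
  have "\<one> = inv u \<otimes> u"
    using assms(2) by (rule Units_l_inv[symmetric])
  then have "\<one> \<in> PIdl u"
    unfolding cgenideal_def using Units_inv_closed[OF assms(2)] by blast
  then have PIdl_u: "PIdl u = carrier R"
    using ideal.one_imp_carrier[OF cgenideal_ideal[OF u]] by blast
  interpret I: ideal "PIdl a" R
    using assms(1) by (rule cgenideal_ideal)
  show ?thesis
  proof
    show "PIdl a <+>\<^bsub>R\<^esub> PIdl u \<subseteq> carrier R"
      unfolding PIdl_u set_add_def' using I.a_subset by auto
    have "x \<in> PIdl a <+>\<^bsub>R\<^esub> carrier R" if "x \<in> carrier R" for x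
    proof -
      have "x = \<zero> \<oplus> x" using that by simp
      then show ?thesis
        unfolding set_add_def' using I.zero_closed that by blast
    qed
    then show "carrier R \<subseteq> PIdl a <+>\<^bsub>R\<^esub> PIdl u"
      unfolding PIdl_u by blast
  qed
qed

text \<open>
  A unit generates the whole ring, so its ideal and that of any other element sum to the ring.
\<close>

lemma Units_universal_comaximal_graph:
  assumes "1 < n"
  shows "Units (residue_ring (int n)) \<subseteq> universal_vertices (comaximal_graph n)"
proof
  let ?R = "residue_ring (int n)"
  interpret residues "int n" ?R
    using assms by unfold_locales simp_all
  fix u assume u: "u \<in> Units ?R"
  then have u_carrier: "u \<in> carrier ?R" by (rule Units_closed)
  have "(v, u) \<in> parcs (comaximal_graph n)" if "v \<in> carrier ?R" "v \<noteq> u" for v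
    using that u_carrier ideal_sum_unit_eq_carrier[OF that(1) u]
    by (simp only: comaximal_graph_def Let_def pair_pre_digraph.simps mem_Collect_eq prod.case
        simp_thms)
  then show "u \<in> universal_vertices (comaximal_graph n)"
    unfolding universal_vertices_def pverts_comaximal_graph with_proj_simps
    by (intro CollectI conjI ballI u_carrier) (simp only: Diff_iff singleton_iff simp_thms)
qed

theorem proposition3p2:
  fixes n p q :: nat
  assumes "prime p" and "prime q" and "p < q" and "n = p * q"
  shows "log_concave (domination_poly (comaximal_graph n)) \<and>
         unimodal (domination_poly (comaximal_graph n))"
proof -
  let ?G = "comaximal_graph n"
  have p: "2 \<le> p" and q: "2 \<le> q"
    using assms prime_ge_2_nat by blast+
  have "1 < n"
    using assms(4) p q by (metis assms(1,2) less_1_mult prime_gt_1_nat)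
  interpret residues "int n" "residue_ring (int n)"
    using \<open>1 < n\<close> by unfold_locales simp_all
  have fin: "finite (pverts ?G)"
    by (simp add: pverts_comaximal_graph)
  have "coprime p q"
    using assms by (intro primes_coprime) auto
  then have "totient n = (p - 1) * (q - 1)"
    using assms by (simp add: totient_mult_coprime totient_prime)
  then have "(p - 1) * (q - 1) = card (Units (residue_ring (int n)))"
    using totient_eq by simp
  also have "\<dots> \<le> card (universal_vertices ?G)"
    using Units_universal_comaximal_graph[OF \<open>1 < n\<close>] fin
    by (intro card_mono) (auto simp: universal_vertices_def)
  finally have many: "(p - 1) * (q - 1) \<le> card (universal_vertices ?G)" .
  \<comment> \<open>In these coordinates the surplus \<open>(p - 2)(q - 2)\<close> is the product \<open>a b\<close>.\<close>
  obtain a b where ab: "p = a + 2" "q = b + 2"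
    using p q by (metis add.commute le_Suc_ex)
  show ?thesis
  proof (rule domination_poly_log_concave_unimodal[OF fin])
    have "0 < (p - 1) * (q - 1)" using p q by simp
    then show "universal_vertices ?G \<noteq> {}" using many by auto
    have "n \<le> 2 * ((p - 1) * (q - 1)) + 2"
      unfolding assms(4) ab by (simp add: algebra_simps)
    then show "card (pverts ?G) \<le> 2 * card (universal_vertices ?G) + 2"
      using many card_pverts_comaximal_graph[of n] by linarith
  qed
qed

end
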